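(* Let $\operatorname{OBJ}(\overline{\mathrm{GW}})$ and $\operatorname{OBJ}(\overline{\mathrm{DW}})$ denote the optimal objective function values of the LP relaxations of the MILP formulations GW and DW of QUBO described below. Then $\operatorname{OBJ}(\overline{\mathrm{GW}})\leq\operatorname{OBJ}(\overline{\mathrm{DW}})$ for every instance. Further, $\operatorname{OBJ}(\overline{\mathrm{DW}})$ could be arbitrarily bad (i.e. arbitrarily larger, for this maximization problem) compared to $\operatorname{OBJ}(\overline{\mathrm{GW}})$.
   Context: QUBO: maximize $\sum_{i=1}^n\sum_{j\in R_i}q_{ij}x_ix_j+\sum_{i=1}^n c_ix_i$ over $x\in\{0,1\}^n$, where $Q=(q_{ij})$ is an $n\times n$ symmetric matrix with zero diagonal, $c\in\mathbb{R}^n$, and $R_i=\{j: q_{ij}\neq 0\}$. DW (Dantzig–Watters) formulation: maximize $\sum_{i}\sum_{j\in R_i}q_{ij}y_{ij}+\sum_i c_ix_i$ subject to $x_i+x_j-y_{ij}\leq 1$ and $2y_{ij}-x_i-x_j\leq 0$ for all $j\in R_i$, $i=1,\ldots,n$; $x_i\in\{0,1\}$; $y_{ij}\in\{0,1\}$. GW (Glover–Woolsey / standard linearization): maximize the same objective subject to $x_i+x_j-y_{ij}\leq 1$, $y_{ij}\leq x_i$ and $y_{ij}\leq x_j$ for all $j\in R_i$, $i=1,\ldots,n$; $x_i\in\{0,1\}$; $y_{ij}\geq 0$. The LP relaxation $\overline{P}$ of a model $P$ is obtained by replacing each binary restriction by the bounds $0\le\cdot\le 1$; $\operatorname{OBJ}(\overline{P})$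 is its optimal value. *)

theory Defs
  imports Complex_Main
begin

text \<open>
  Vectors in \<open>\<real>\<^sup>n\<close> and \<open>n \<times> n\<close> matrices are functions on natural-number indices; only the entries
  with indices in \<open>{1..n}\<close> are ever used.  An instance of QUBO is given by \<open>n\<close>, \<open>q\<close> and \<open>c\<close>, where
  \<open>c\<close> is unrestricted.
\<close>

definition qubo_instance :: "nat \<Rightarrow> (nat \<Rightarrow> nat \<Rightarrow> real) \<Rightarrow> (nat \<Rightarrow> real) \<Rightarrow> bool" where
  "qubo_instance n q c \<longleftrightarrow>
     (\<forall>i\<in>{1..n}. \<forall>j\<in>{1..n}. q i j = q j i) \<and> (\<forall>i\<in>{1..n}. q i i = 0)"

definition nonzero_cols :: "nat \<Rightarrow> (nat \<Rightarrow> nat \<Rightarrow> real) \<Rightarrow> nat \<Rightarrow> nat set" where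
  "nonzero_cols n q i = {j \<in> {1..n}. q i j \<noteq> 0}"

definition lin_objective ::
  "nat \<Rightarrow> (nat \<Rightarrow> nat \<Rightarrow> real) \<Rightarrow> (nat \<Rightarrow> real) \<Rightarrow> (nat \<Rightarrow> real) \<Rightarrow> (nat \<Rightarrow> nat \<Rightarrow> real) \<Rightarrow> real" where
  "lin_objective n q c x y =
     (\<Sum>i=1..n. \<Sum>j\<in>nonzero_cols n q i. q i j * y i j) + (\<Sum>i=1..n. c i * x i)"

text \<open>
  The parameter \<open>B\<close> is the range of the variables that are binary in the model: \<open>B = {0, 1}\<close> gives the
  mixed-integer program and \<open>B = {0..1}\<close> its LP relaxation.  The variables \<open>y i j\<close> exist only for
  \<open>j \<in> nonzero_cols n q i\<close>; other values of \<open>y\<close> are unconstrained and do not enter the objective.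
  The variables \<open>y i j\<close> and \<open>y j i\<close> are distinct.
\<close>

definition dw_feasible ::
  "real set \<Rightarrow> nat \<Rightarrow> (nat \<Rightarrow> nat \<Rightarrow> real) \<Rightarrow> (nat \<Rightarrow> real) \<Rightarrow> (nat \<Rightarrow> nat \<Rightarrow> real) \<Rightarrow> bool" where
  "dw_feasible B n q x y \<longleftrightarrow>
     (\<forall>i\<in>{1..n}. x i \<in> B) \<and>
     (\<forall>i\<in>{1..n}. \<forall>j\<in>nonzero_cols n q i.
        x i + x j - y i j \<le> 1 \<and> 2 * y i j - x i - x j \<le> 0 \<and> y i j \<in> B)"

definition gw_feasible ::
  "real set \<Rightarrow> nat \<Rightarrow> (nat \<Rightarrow> nat \<Rightarrow> real) \<Rightarrow> (nat \<Rightarrow> real) \<Rightarrow> (nat \<Rightarrow> nat \<Rightarrow> real) \<Rightarrow> bool" where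
  "gw_feasible B n q x y \<longleftrightarrow>
     (\<forall>i\<in>{1..n}. x i \<in> B) \<and>
     (\<forall>i\<in>{1..n}. \<forall>j\<in>nonzero_cols n q i.
        x i + x j - y i j \<le> 1 \<and> y i j \<le> x i \<and> y i j \<le> x j \<and> y i j \<ge> 0)"

definition dw_lp_values ::
  "nat \<Rightarrow> (nat \<Rightarrow> nat \<Rightarrow> real) \<Rightarrow> (nat \<Rightarrow> real) \<Rightarrow> real set" where
  "dw_lp_values n q c = {lin_objective n q c x y | x y. dw_feasible {0..1} n q x y}"

definition gw_lp_values ::
  "nat \<Rightarrow> (nat \<Rightarrow> nat \<Rightarrow> real) \<Rightarrow> (nat \<Rightarrow> real) \<Rightarrow> real set" where
  "gw_lp_values n q c = {lin_objective n q c x y | x y. gw_feasible {0..1} n q x y}"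

text \<open>
  The suprema below are genuine: both sets of objective values are nonempty and bounded above, as
  shown in the lemmas that follow.
\<close>

definition OBJ_DW_LP :: "nat \<Rightarrow> (nat \<Rightarrow> nat \<Rightarrow> real) \<Rightarrow> (nat \<Rightarrow> real) \<Rightarrow> real" where
  "OBJ_DW_LP n q c = Sup (dw_lp_values n q c)"

definition OBJ_GW_LP :: "nat \<Rightarrow> (nat \<Rightarrow> nat \<Rightarrow> real) \<Rightarrow> (nat \<Rightarrow> real) \<Rightarrow> real" where
  "OBJ_GW_LP n q c = Sup (gw_lp_values n q c)"

lemma dw_lp_values_nonempty: "dw_lp_values n q c \<noteq> {}"
proof -
  have "dw_feasible {0..1} n q (\<lambda>_. 0) (\<lambda>_ _. 0)"
    by (simp add: dw_feasible_def)
  then show ?thesis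
    unfolding dw_lp_values_def by blast
qed

lemma gw_lp_values_nonempty: "gw_lp_values n q c \<noteq> {}"
proof -
  have "gw_feasible {0..1} n q (\<lambda>_. 0) (\<lambda>_ _. 0)"
    by (simp add: gw_feasible_def)
  then show ?thesis
    unfolding gw_lp_values_def by blast
qed

lemma mult_unit_le_abs: "a * t \<le> \<bar>a\<bar>" if "0 \<le> t" "t \<le> 1" for a t :: real
proof -
  have "a * t \<le> \<bar>a\<bar> * t"
    using that by (simp add: mult_right_mono)
  also have "\<dots> \<le> \<bar>a\<bar>"
    using that by (simp add: mult_left_le)
  finally show ?thesis .
qed

lemma lin_objective_le:
  assumes "\<And>i. i \<in> {1..n} \<Longrightarrow> x i \<in> {0..1}"
    and "\<And>i j. i \<in> {1..n} \<Longrightarrow> j \<in> nonzero_cols n q i \<Longrightarrow> y i j \<in> {0..1}"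
  shows "lin_objective n q c x y \<le>
    (\<Sum>i=1..n. \<Sum>j\<in>nonzero_cols n q i. \<bar>q i j\<bar>) + (\<Sum>i=1..n. \<bar>c i\<bar>)"
  unfolding lin_objective_def
proof (intro add_mono sum_mono)
  fix i j assume "i \<in> {1..n}" "j \<in> nonzero_cols n q i"
  then show "q i j * y i j \<le> \<bar>q i j\<bar>"
    using assms(2)[of i j] by (intro mult_unit_le_abs) auto
next
  fix i assume "i \<in> {1..n}"
  then show "c i * x i \<le> \<bar>c i\<bar>"
    using assms(1)[of i] by (intro mult_unit_le_abs) auto
qed

lemma dw_lp_values_bdd_above: "bdd_above (dw_lp_values n q c)"
proof (rule bdd_aboveI)
  fix v assume "v \<in> dw_lp_values n q c"
  then obtain x y where v: "v = lin_objective n q c x y" and f: "dw_feasible {0..1} n q x y"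
    unfolding dw_lp_values_def by blast
  show "v \<le> (\<Sum>i=1..n. \<Sum>j\<in>nonzero_cols n q i. \<bar>q i j\<bar>) + (\<Sum>i=1..n. \<bar>c i\<bar>)"
    unfolding v using f by (intro lin_objective_le) (simp_all add: dw_feasible_def)
qed

lemma gw_lp_values_bdd_above: "bdd_above (gw_lp_values n q c)"
proof (rule bdd_aboveI)
  fix v assume "v \<in> gw_lp_values n q c"
  then obtain x y where v: "v = lin_objective n q c x y" and f: "gw_feasible {0..1} n q x y"
    unfolding gw_lp_values_def by blast
  have "y i j \<in> {0..1}" if "i \<in> {1..n}" "j \<in> nonzero_cols n q i" for i j
  proof -
    have "0 \<le> y i j" "y i j \<le> x i" "x i \<le> 1"
      using f that unfolding gw_feasible_def by auto
    then show ?thesis by simp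
  qed
  then show "v \<le> (\<Sum>i=1..n. \<Sum>j\<in>nonzero_cols n q i. \<bar>q i j\<bar>) + (\<Sum>i=1..n. \<bar>c i\<bar>)"
    unfolding v using f by (intro lin_objective_le) (simp_all add: gw_feasible_def)
qed

text \<open>With binary variables, both models linearize the products \<open>x i * x j\<close>.\<close>

lemma dw_feasible_binary_product:
  assumes "dw_feasible {0, 1} n q x y" "i \<in> {1..n}" "j \<in> nonzero_cols n q i"
  shows "y i j = x i * x j"
proof -
  have "j \<in> {1..n}" using assms(3) by (simp add: nonzero_cols_def)
  then have "x i \<in> {0, 1}" "x j \<in> {0, 1}" "y i j \<in> {0, 1}"
    "x i + x j - y i j \<le> 1" "2 * y i j - x i - x j \<le> 0"
    using assms unfolding dw_feasible_def by blast+
  then show ?thesis by auto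
qed

lemma gw_feasible_binary_product:
  assumes "gw_feasible {0, 1} n q x y" "i \<in> {1..n}" "j \<in> nonzero_cols n q i"
  shows "y i j = x i * x j"
proof -
  have "j \<in> {1..n}" using assms(3) by (simp add: nonzero_cols_def)
  then have "x i \<in> {0, 1}" "x j \<in> {0, 1}"
    "x i + x j - y i j \<le> 1" "y i j \<le> x i" "y i j \<le> x j" "0 \<le> y i j"
    using assms unfolding gw_feasible_def by blast+
  then show ?thesis by auto
qed

end

theory Submission imports Defs begin

text \<open>
  Every point feasible for the GW relaxation is feasible for the DW relaxation: adding \<open>y \<le> x\<^sub>i\<close> and
  \<open>y \<le> x\<^sub>j\<close> gives \<open>2 y \<le> x\<^sub>i + x\<^sub>j\<close>.  The gap comes from the point \<open>x = (1, 0)\<close>, where DW still permits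
  \<open>y = 1/2\<close> while GW forces \<open>y = 0\<close>.  With two variables, \<open>q\<^sub>1\<^sub>2 = a\<close> and \<open>c = (1, -2a)\<close>, DW gains \<open>a\<close>
  at this point, whereas in GW the cost \<open>2a x\<^sub>2\<close> absorbs the whole quadratic term.
\<close>

lemma gw_feasible_imp_dw_feasible:
  assumes "gw_feasible {0..1} n q x y"
  shows "dw_feasible {0..1} n q x y"
  \<comment> \<open>The DW bound \<open>y i j \<le> 1\<close>, not stated in GW, comes from
    \<open>y i j \<le> x i \<le> 1\<close>.\<close>
  using assms unfolding gw_feasible_def dw_feasible_def by fastforce

lemma OBJ_GW_LP_le_OBJ_DW_LP: "OBJ_GW_LP n q c \<le> OBJ_DW_LP n q c"
  unfolding OBJ_GW_LP_def OBJ_DW_LP_def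
proof (rule cSup_subset_mono)
  show "gw_lp_values n q c \<subseteq> dw_lp_values n q c"
    unfolding gw_lp_values_def dw_lp_values_def using gw_feasible_imp_dw_feasible by blast
qed (rule gw_lp_values_nonempty dw_lp_values_bdd_above)+

lemma OBJ_DW_LP_upper:
  "dw_feasible {0..1} n q x y \<Longrightarrow> lin_objective n q c x y \<le> OBJ_DW_LP n q c"
  unfolding OBJ_DW_LP_def
  by (rule cSup_upper[OF _ dw_lp_values_bdd_above]) (auto simp: dw_lp_values_def)

lemma OBJ_GW_LP_upper:
  "gw_feasible {0..1} n q x y \<Longrightarrow> lin_objective n q c x y \<le> OBJ_GW_LP n q c"
  unfolding OBJ_GW_LP_def
  by (rule cSup_upper[OF _ gw_lp_values_bdd_above]) (auto simp: gw_lp_values_def)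

lemma OBJ_GW_LP_least:
  assumes "\<And>x y. gw_feasible {0..1} n q x y \<Longrightarrow> lin_objective n q c x y \<le> b"
  shows "OBJ_GW_LP n q c \<le> b"
  unfolding OBJ_GW_LP_def
  by (rule cSup_least[OF gw_lp_values_nonempty]) (auto simp: gw_lp_values_def assms)

definition gap_q :: "real \<Rightarrow> nat \<Rightarrow> nat \<Rightarrow> real" where
  "gap_q a i j = (if i = j then 0 else a)"

text \<open>The reward 1 keeps the GW optimum positive, so that a ratio of optima is meaningful. The
  cost is \<open>2 * a\<close> because \<open>y 1 2\<close> and \<open>y 2 1\<close> are separate
  variables, each worth at most \<open>a * x 2\<close> under GW when \<open>a > 0\<close>.\<close>

definition gap_c :: "real \<Rightarrow> nat \<Rightarrow> real" where
  "gap_c a i = (if i = 1 then 1 else - 2 * a)"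

lemma qubo_instance_gap: "qubo_instance n (gap_q a) c"
  by (simp add: qubo_instance_def gap_q_def)

lemma atLeastAtMost_1_2: "{1..2} = {1, 2 :: nat}"
  by auto

lemma nonzero_cols_gap:
  assumes "a \<noteq> 0"
  shows "nonzero_cols 2 (gap_q a) 1 = {2}" "nonzero_cols 2 (gap_q a) 2 = {1}"
  using assms by (auto simp: nonzero_cols_def gap_q_def)

lemma lin_objective_gap:
  assumes "a \<noteq> 0"
  shows "lin_objective 2 (gap_q a) (gap_c a) x y = a * y 1 2 + a * y 2 1 + x 1 - 2 * a * x 2"
  unfolding lin_objective_def atLeastAtMost_1_2
  using nonzero_cols_gap[OF assms] by (simp add: gap_q_def gap_c_def)

lemma OBJ_GW_LP_gap:
  assumes "a > 0"
  shows "OBJ_GW_LP 2 (gap_q a) (gap_c a) = 1"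
proof (rule antisym)
  show "OBJ_GW_LP 2 (gap_q a) (gap_c a) \<le> 1"
  proof (rule OBJ_GW_LP_least)
    fix x y assume "gw_feasible {0..1} 2 (gap_q a) x y"
    then have "x 1 \<le> 1" "y 1 2 \<le> x 2" "y 2 1 \<le> x 2"
      using assms nonzero_cols_gap[of a] unfolding gw_feasible_def atLeastAtMost_1_2 by auto
    moreover from this have "a * y 1 2 \<le> a * x 2" "a * y 2 1 \<le> a * x 2"
      using assms by simp_all
    ultimately show "lin_objective 2 (gap_q a) (gap_c a) x y \<le> 1"
      using assms by (subst lin_objective_gap) linarith+
  qed
next
  \<comment> \<open>The bound 1 is attained at \<open>x = (1, 0)\<close> with
    \<open>y = 0\<close>.\<close>
  define x :: "nat \<Rightarrow> real" where "x i = (if i = 1 then 1 else 0)" for i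
  have "gw_feasible {0..1} 2 (gap_q a) x (\<lambda>_ _. 0)"
    using assms nonzero_cols_gap[of a] unfolding gw_feasible_def atLeastAtMost_1_2
    by (auto simp: x_def)
  from OBJ_GW_LP_upper[OF this, of "gap_c a"] show "1 \<le> OBJ_GW_LP 2 (gap_q a) (gap_c a)"
    using assms by (simp add: lin_objective_gap x_def)
qed

text \<open>At \<open>x = (1, 0)\<close> both \<open>y 1 2\<close> and \<open>y 2 1\<close> can be
  1/2, each contributing \<open>a / 2\<close> on top of the reward 1. A lower bound on the optimum
  suffices for the gap.\<close>

lemma OBJ_DW_LP_gap:
  assumes "a > 0"
  shows "a + 1 \<le> OBJ_DW_LP 2 (gap_q a) (gap_c a)"
proof -
  define x :: "nat \<Rightarrow> real" where "x i = (if i = 1 then 1 else 0)" for i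
  have "dw_feasible {0..1} 2 (gap_q a) x (\<lambda>_ _. 1/2)"
    using assms nonzero_cols_gap[of a] unfolding dw_feasible_def atLeastAtMost_1_2
    by (auto simp: x_def)
  from OBJ_DW_LP_upper[OF this, of "gap_c a"] show ?thesis
    using assms by (simp add: lin_objective_gap x_def)
qed

theorem theorem22:
  shows "(\<forall>(n::nat) (q :: nat \<Rightarrow> nat \<Rightarrow> real) (c :: nat \<Rightarrow> real).
            qubo_instance n q c \<longrightarrow> OBJ_GW_LP n q c \<le> OBJ_DW_LP n q c) \<and>
         (\<forall>M::real. \<exists>(n::nat) (q :: nat \<Rightarrow> nat \<Rightarrow> real) (c :: nat \<Rightarrow> real).
            qubo_instance n q c \<and> OBJ_GW_LP n q c > 0 \<and>
            OBJ_DW_LP n q c > M * OBJ_GW_LP n q c \<and>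
            OBJ_DW_LP n q c - OBJ_GW_LP n q c > M)"
proof (intro conjI allI impI)
  fix n q c
  show "OBJ_GW_LP n q c \<le> OBJ_DW_LP n q c"
    by (rule OBJ_GW_LP_le_OBJ_DW_LP)
next
  fix M :: real
  \<comment> \<open>As the GW optimum is 1 and the DW optimum at least \<open>a + 1\<close>, any
    positive \<open>a > M\<close> makes both the ratio and the difference exceed
    \<open>M\<close>.\<close>
  define a where "a = \<bar>M\<bar> + 1"
  have "a > 0" "a > M"
    unfolding a_def by linarith+
  then show "\<exists>n q c. qubo_instance n q c \<and> OBJ_GW_LP n q c > 0 \<and>
      OBJ_DW_LP n q c > M * OBJ_GW_LP n q c \<and> OBJ_DW_LP n q c - OBJ_GW_LP n q c > M"
    using qubo_instance_gap[of 2 a "gap_c a"] OBJ_GW_LP_gap[of a] OBJ_DW_LP_gap[of a]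
    by (intro exI[of _ 2] exI[of _ "gap_q a"] exI[of _ "gap_c a"]) simp
qed

end
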